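(* Each maximal subgroup of $\mathcal{L}_n$ has finite index and is either of the form $\mathcal{A}_n\rtimes q\mathbb{Z}$ for some prime $q\in\mathbb{Z}$, in which case its index is $q$, or its triple is $(1,V_0,v)$ with ${\det}^*V_0$ an irreducible polynomial, in which case its index is $p^{\deg({\det}^*V_0)}$. Maximal subgroups of the form $\mathcal{A}_n\rtimes q\mathbb{Z}$ are normal. A maximal subgroup with triple $(1,V_0,v)$ is normal if and only if ${\det}^*V_0=1-x$.
   Context: $p$ is a fixed prime, $n\ge 1$, $R=\mathbb{F}_p[x,x^{-1}]$. $\mathcal{A}_n=\bigoplus_{\mathbb{Z}}(\mathbb{Z}/p\mathbb{Z})^n$ is identified with the additive group of $R^n$, so that the shift by one on $\mathcal{A}_n$ is multiplication by $x$. $\mathcal{L}_n=(\mathbb{Z}/p\mathbb{Z})^n\wr\mathbb{Z}=\mathcal{A}_n\rtimes\mathbb{Z}$, with elements written $(v,s)$ and multiplication $(v,s)(w,t)=(v+x^sw,s+t)$; $\mathcal{A}_n$ is identified with $\{(v,0)\}$. The triple $(s,V_0,v)$ of a subgroup $V\le\mathcal{L}_n$: $s\ge 0$ is the integer such that $s\mathbb{Z}$ is the image of $V$ under the projection to $\mathbb{Z}$, $V_0=V\cap\mathcal{A}_n$ (it satisfies $x^sV_0=V_0$), and $v\in\mathcal{A}_n$ is any element with $(v,s)\in V$ (well defined modulo $V_0$; for $s=0$ one takes $v=0$). When $s=1$, $V_0$ is an $R$-submodule of $R^n$. For an $R$-submodule $U\subset R^n$, write $R^n/U\cong\bigoplus_{i=1}^m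 R/q_i^{r_i}R$ with $r_i\ge 1$ and each $q_i$ either $0$ or an irreducible polynomial in $\mathbb{F}_p[x]$ with $q_i(0)=1$ (the $q_i,r_i$ are unique up to permutation); then ${\det}^*U=\prod_{i:\,q_i\ne 0}q_i^{r_i}\in\mathbb{F}_p[x]$. *)

theory Defs
  imports
    "HOL-Analysis.Finite_Cartesian_Product"
    "HOL-Library.Poly_Mapping"
    "HOL-Library.Set_Algebras"
    "HOL-Library.FuncSet"
    "HOL-Algebra.Coset"
    "Berlekamp_Zassenhaus.Finite_Field"
begin

text \<open>
  The prime is \<open>CARD('p)\<close> and the rank is \<open>CARD('n)\<close>; both are fixed throughout.
  A finitely supported function \<open>int \<Rightarrow> 'p mod_ring\<close>, with the convolution product of
  \<open>Poly_Mapping\<close>, is a Laurent polynomial over the prime field.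
\<close>

type_synonym 'p laurent = "int \<Rightarrow>\<^sub>0 'p mod_ring"

type_synonym ('p, 'n) base = "('p laurent, 'n) vec"

definition laurent_x :: "int \<Rightarrow> 'p::prime_card laurent" where
  "laurent_x s = Poly_Mapping.single s 1"

definition laurent_of_poly :: "'p::prime_card mod_ring poly \<Rightarrow> 'p laurent" where
  "laurent_of_poly f = (\<Sum>i\<le>degree f. Poly_Mapping.single (int i) (coeff f i))"

definition wreath :: "(('p::prime_card, 'n::finite) base \<times> int) monoid" where
  "wreath =
    \<lparr>carrier = UNIV,
     monoid.mult = (\<lambda>(v, s) (w, t). (v + laurent_x s *s w, s + t)),
     monoid.one = (0, 0)\<rparr>"

definition maximal_subgroup :: "'a set \<Rightarrow> ('a, 'b) monoid_scheme \<Rightarrow> bool" where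
  "maximal_subgroup H G \<longleftrightarrow>
    subgroup H G \<and> H \<noteq> carrier G \<and>
    (\<forall>K. subgroup K G \<longrightarrow> H \<subseteq> K \<longrightarrow> K = H \<or> K = carrier G)"

definition base_rtimes :: "nat \<Rightarrow> (('p::prime_card, 'n::finite) base \<times> int) set" where
  "base_rtimes q = UNIV \<times> range ((*) (int q))"

text \<open>
  A relation rather than a function of \<open>V\<close>, since \<open>v\<close> is only determined modulo \<open>V0\<close>.
\<close>

definition has_triple ::
    "(('p::prime_card, 'n::finite) base \<times> int) set \<Rightarrow>
     nat \<Rightarrow> ('p, 'n) base set \<Rightarrow> ('p, 'n) base \<Rightarrow> bool" where
  "has_triple V s V0 v \<longleftrightarrow>
    snd ` V = range ((*) (int s)) \<and>
    V0 = {w. (w, 0) \<in> V} \<and>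
    (v, int s) \<in> V \<and>
    (s = 0 \<longrightarrow> v = 0)"

definition cosets :: "'a::ab_group_add set \<Rightarrow> 'a set set" where
  "cosets U = range (\<lambda>v. v +o U)"

text \<open>
  The action of a ring on the quotient by a submodule \<open>U\<close>: it sends \<open>v + U\<close> to
  \<open>c v + U\<close>. Adding \<open>U\<close> is needed because the image of a coset under multiplication
  by \<open>c\<close> need not be a whole coset.
\<close>

definition coset_scale ::
    "('r \<Rightarrow> 'm::ab_group_add \<Rightarrow> 'm) \<Rightarrow> 'm set \<Rightarrow> 'r \<Rightarrow> 'm set \<Rightarrow> 'm set" where
  "coset_scale act U c C = act c ` C + U"

text \<open>
  \<open>R\<^sup>n / U \<cong> \<Oplus>\<^sub>i R / a\<^sub>i R\<close> (\<open>i < m\<close>) as modules; the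
  addition of cosets is the elementwise sum of sets.
\<close>

definition quotient_iso ::
    "('p::prime_card, 'n::finite) base set \<Rightarrow> nat \<Rightarrow> (nat \<Rightarrow> 'p laurent) \<Rightarrow> bool" where
  "quotient_iso U m a \<longleftrightarrow>
    (\<exists>f. bij_betw f (cosets U) (\<Pi>\<^sub>E i\<in>{..<m}. cosets (range ((*) (a i)))) \<and>
      (\<forall>C\<in>cosets U. \<forall>D\<in>cosets U. \<forall>i<m. f (C + D) i = f C i + f D i) \<and>
      (\<forall>c. \<forall>C\<in>cosets U. \<forall>i<m.
        f (coset_scale (*s) U c C) i = coset_scale (*) (range ((*) (a i))) c (f C i)))"

definition cyclic_decomposition ::
    "('p::prime_card, 'n::finite) base set \<Rightarrow>
     nat \<Rightarrow> (nat \<Rightarrow> 'p mod_ring poly) \<Rightarrow> (nat \<Rightarrow> nat) \<Rightarrow> bool" where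
  "cyclic_decomposition U m q r \<longleftrightarrow>
    (\<forall>i<m. 1 \<le> r i \<and> (q i = 0 \<or> Factorial_Ring.irreducible (q i) \<and> poly (q i) 0 = 1)) \<and>
    quotient_iso U m (\<lambda>i. laurent_of_poly (q i) ^ r i)"

text \<open>
  Meaningful for submodules \<open>U\<close> only; for these a decomposition exists and the
  product does not depend on it.
\<close>

definition det_star :: "('p::prime_card, 'n::finite) base set \<Rightarrow> 'p mod_ring poly" where
  "det_star U =
    (THE d. \<exists>m q r. cyclic_decomposition U m q r \<and>
      d = (\<Prod>i\<in>{i. i < m \<and> q i \<noteq> 0}. q i ^ r i))"

lemma group_wreath: "group (wreath :: (('p::prime_card, 'n::finite) base \<times> int) monoid)"
proof (rule groupI)
  fix g :: "('p, 'n) base \<times> int"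
  obtain v s where g: "g = (v, s)" by (cases g)
  have "(- (laurent_x (- s) *s v), - s) \<otimes>\<^bsub>wreath\<^esub> g = \<one>\<^bsub>wreath\<^esub>"
    by (simp add: wreath_def g)
  then show "\<exists>h\<in>carrier wreath. h \<otimes>\<^bsub>wreath\<^esub> g = \<one>\<^bsub>wreath\<^esub>"
    by (rule bexI) (simp add: wreath_def)
qed (auto simp: wreath_def laurent_x_def vec_eq_iff algebra_simps mult_single
      simp flip: mult.assoc)

end

theory Submission
  imports Defs
begin

text \<open>
  If the image \<open>s\<int>\<close> of a maximal subgroup \<open>V\<close> in \<open>\<int>\<close> is proper, a prime \<open>q\<close> divides \<open>s\<close> and \<open>V\<close>
  lies in, hence equals, \<open>A \<rtimes> q\<int>\<close>. If the image is \<open>\<int>\<close>, conjugation makes \<open>V0 = V \<inter> A\<close> a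
  submodule of \<open>R\<^sup>n\<close>, and any submodule \<open>W \<supseteq> V0\<close> gives the subgroup \<open>W V \<supseteq> V\<close>, so \<open>V0\<close> is
  maximal. The simple module \<open>R\<^sup>n / V0\<close> is generated by the class of any \<open>e \<notin> V0\<close>, so it is
  \<open>R / f R\<close> for an irreducible \<open>f\<close> with \<open>f(0) = 1\<close>, which has \<open>p\<close> to the power \<open>deg f\<close> elements,
  as many as \<open>V\<close> has cosets. Any cyclic decomposition of a simple module has one summand, whose
  annihilator must be \<open>f R\<close>, so the determinant is \<open>f\<close>. Finally, commutators with an element of
  \<open>V\<close> above \<open>1\<close> show that normality forces \<open>(1 - x) R\<^sup>n \<subseteq> V0\<close>, that is \<open>f = 1 - x\<close>; conversely
  the quotient of the group by \<open>(1 - x) R\<^sup>n\<close> is abelian.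
\<close>

section \<open>Laurent polynomials\<close>

text \<open>Turns the step of \<open>update_induct\<close> into the addition of one monomial, so
  that claims about Laurent polynomials can be proved by building them up monomial by
  monomial.\<close>

lemma update_eq_single_add:
  fixes a :: "'a \<Rightarrow>\<^sub>0 'b::monoid_add"
  assumes "k \<notin> Poly_Mapping.keys a"
  shows "Poly_Mapping.update k c a = Poly_Mapping.single k c + a"
  using assms by (intro poly_mapping_eqI)
    (auto simp: lookup_update lookup_add lookup_single when_def in_keys_iff)

lemma lookup_laurent_of_poly:
  "Poly_Mapping.lookup (laurent_of_poly f) k = (if k < 0 then 0 else coeff f (nat k))"
proof -
  have "(\<Sum>i\<le>degree f. if int i = k then coeff f i else 0) = (if k < 0 then 0 else coeff f (nat k))"
  proof (cases "k < 0")
    case False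
    then have "(\<Sum>i\<le>degree f. if int i = k then coeff f i else 0)
      = (\<Sum>i\<le>degree f. if i = nat k then coeff f i else 0)"
      by (intro sum.cong) auto
    then show ?thesis
      using False by (auto simp: coeff_eq_0 not_le)
  qed (auto intro!: sum.neutral)
  then show ?thesis
    by (simp add: laurent_of_poly_def lookup_sum lookup_single when_def)
qed

lemma laurent_of_poly_0 [simp]: "laurent_of_poly 0 = 0"
  by (simp add: laurent_of_poly_def)

lemma laurent_of_poly_1 [simp]: "laurent_of_poly 1 = 1"
  by (simp add: laurent_of_poly_def)

lemma laurent_of_poly_add: "laurent_of_poly (f + g) = laurent_of_poly f + laurent_of_poly g"
  by (rule poly_mapping_eqI) (simp add: lookup_laurent_of_poly lookup_add)

lemma laurent_of_poly_diff: "laurent_of_poly (f - g) = laurent_of_poly f - laurent_of_poly g"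
  by (rule poly_mapping_eqI) (simp add: lookup_laurent_of_poly lookup_minus)

lemma laurent_of_poly_minus: "laurent_of_poly (- f) = - laurent_of_poly f"
  using laurent_of_poly_diff[of 0 f] by simp

lemma laurent_of_poly_eq_iff [simp]: "laurent_of_poly f = laurent_of_poly g \<longleftrightarrow> f = g"
proof
  assume eq: "laurent_of_poly f = laurent_of_poly g"
  show "f = g"
  proof (rule poly_eqI)
    fix i
    show "coeff f i = coeff g i"
      using arg_cong[OF eq, of "\<lambda>a. Poly_Mapping.lookup a (int i)"]
      by (simp add: lookup_laurent_of_poly)
  qed
qed simp

lemma laurent_x_0 [simp]: "laurent_x 0 = 1"
  by (simp add: laurent_x_def)

lemma laurent_x_add: "laurent_x (s + t) = laurent_x s * laurent_x t"
  by (simp add: laurent_x_def mult_single)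

lemma lookup_laurent_x_mult: "Poly_Mapping.lookup (laurent_x s * a) k = Poly_Mapping.lookup a (k - s)"
proof (induction a rule: update_induct)
  case const
  then show ?case by simp
next
  case (update a b c)
  show ?case
    unfolding update_eq_single_add[OF update.hyps(1)] using update.IH
    by (auto simp: distrib_left lookup_add laurent_x_def mult_single lookup_single when_def)
qed

lemma laurent_of_poly_pCons:
  "laurent_of_poly (pCons c f) = Poly_Mapping.single 0 c + laurent_x 1 * laurent_of_poly f"
  by (rule poly_mapping_eqI)
    (auto simp: lookup_laurent_of_poly lookup_add lookup_laurent_x_mult lookup_single when_def
      coeff_pCons nat_diff_distrib split: nat.splits)

lemma laurent_of_poly_smult: "laurent_of_poly (smult c f) = Poly_Mapping.single 0 c * laurent_of_poly f"
  by (simp add: laurent_of_poly_def sum_distrib_left mult_single) 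

lemma laurent_of_poly_mult: "laurent_of_poly (f * g) = laurent_of_poly f * laurent_of_poly g"
proof (induction f)
  case (pCons c f)
  then show ?case
    by (simp add: laurent_of_poly_add laurent_of_poly_smult laurent_of_poly_pCons algebra_simps)
qed simp

lemma laurent_of_poly_power: "laurent_of_poly (f ^ k) = laurent_of_poly f ^ k"
  by (induction k) (simp_all add: laurent_of_poly_mult)

lemma laurent_x_eq_of_poly: "laurent_x (int k) = laurent_of_poly (monom 1 k)"
  by (rule poly_mapping_eqI)
    (auto simp: lookup_laurent_of_poly laurent_x_def lookup_single when_def)

text \<open>Only finitely many exponents occur, so a large power of \<open>x\<close> clears the
  negative ones. As \<open>x\<close> is a unit, questions about Laurent polynomials thereby become
  questions about ordinary ones.\<close>

lemma laurent_shift_poly: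
  obtains k f where "laurent_x (int k) * a = laurent_of_poly f"
proof -
  have "\<exists>k f. laurent_x (int k) * a = laurent_of_poly f"
  proof (induction a rule: update_induct)
    case const
    have "laurent_x (int 0) * 0 = laurent_of_poly 0" by simp
    then show ?case by blast
  next
    case (update a b c)
    then obtain k f where f: "laurent_x (int k) * a = laurent_of_poly f" by blast
    \<comment> \<open>Large enough that the exponent \<open>b + int (k + l)\<close> of the new
      monomial is nonnegative, whatever the sign of \<open>b\<close>.\<close>
    define l where "l = nat \<bar>b\<bar>"
    have "Poly_Mapping.single (b + int (k + l)) c
      = laurent_of_poly (monom c (nat (b + int (k + l))))"
      by (rule poly_mapping_eqI) (auto simp: lookup_laurent_of_poly lookup_single when_def l_def)
    then have "laurent_x (int (k + l)) * Poly_Mapping.update b c a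
      = laurent_of_poly (monom c (nat (b + int (k + l))) + monom 1 l * f)"
      unfolding update_eq_single_add[OF update.hyps(1)]
      by (simp add: laurent_of_poly_add laurent_of_poly_mult distrib_left laurent_x_add
          flip: laurent_x_eq_of_poly f)
        (simp add: laurent_x_def mult_single ac_simps flip: mult.assoc)
    then show ?case by blast
  qed
  with that show ?thesis by blast
qed

section \<open>Divisibility and congruences: from Laurent to ordinary polynomials\<close>

text \<open>If \<open>c\<close> divides \<open>f\<close>, it does not vanish at 0; so when
  \<open>c * k\<close> is the polynomial \<open>x\<close>, the root at 0 belongs to
  \<open>k\<close>, and cancelling \<open>x\<close> makes \<open>c\<close> a unit.\<close>

lemma coprime_monom:
  fixes f :: "'p::prime_card mod_ring poly"
  assumes "poly f 0 \<noteq> 0"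
  shows "coprime f (monom 1 k)"
proof -
  have "coprime f [:0, 1:]"
  proof (rule coprimeI)
    fix c assume "c dvd f" "c dvd [:0, 1:]"
    then obtain k l where k: "[:0, 1:] = c * k" and l: "f = c * l"
      by (meson dvdE)
    have "poly c 0 * poly k 0 = 0"
      using arg_cong[OF k, of "\<lambda>u. poly u 0"] by simp
    with assms l have "poly k 0 = 0"
      by auto
    then obtain k' where "k = [:0, 1:] * k'"
      using poly_eq_0_iff_dvd[of k 0] by (auto elim: dvdE)
    with k have "c * k' = 1"
      by (metis mult.left_commute mult_cancel_left mult.right_neutral pCons_eq_0_iff zero_neq_one)
    then show "is_unit c"
      by (metis dvdI)
  qed
  then show ?thesis
    by (simp add: monom_altdef coprime_power_right_iff)
qed

text \<open>A power of \<open>x\<close> makes the Laurent cofactor a polynomial, and that power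
  cancels because it is coprime to \<open>f\<close>.\<close>

lemma laurent_of_poly_dvd_iff:
  fixes f :: "'p::prime_card mod_ring poly"
  assumes "poly f 0 \<noteq> 0"
  shows "laurent_of_poly f dvd laurent_of_poly g \<longleftrightarrow> f dvd g"
proof
  assume "laurent_of_poly f dvd laurent_of_poly g"
  then obtain a where a: "laurent_of_poly g = laurent_of_poly f * a" ..
  obtain k h where h: "laurent_x (int k) * a = laurent_of_poly h" by (rule laurent_shift_poly)
  have "laurent_of_poly (monom 1 k * g) = laurent_of_poly f * (laurent_x (int k) * a)"
    by (simp add: laurent_of_poly_mult laurent_x_eq_of_poly a ac_simps)
  also have "\<dots> = laurent_of_poly (f * h)"
    by (simp add: h laurent_of_poly_mult)
  finally have "f dvd monom 1 k * g" by simp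
  then show "f dvd g"
    using coprime_monom[OF assms] coprime_dvd_mult_right_iff by blast
next
  assume "f dvd g"
  then show "laurent_of_poly f dvd laurent_of_poly g"
    by (auto elim!: dvdE simp: laurent_of_poly_mult)
qed

text \<open>Writing \<open>f = 1 + x h\<close> shows that the inverse of \<open>x\<close> is
  congruent to \<open>- h\<close> modulo \<open>f\<close>, so negative powers can be traded for
  polynomials.\<close>

lemma laurent_cong_poly:
  fixes f :: "'p::prime_card mod_ring poly"
  assumes "poly f 0 = 1"
  obtains g where "laurent_of_poly f dvd a - laurent_of_poly g"
proof -
  obtain h where f: "f = pCons 1 h"
    using assms by (cases f) auto
  have x: "laurent_x (- 1) - laurent_of_poly (- h) = laurent_of_poly f * laurent_x (- 1)"
    by (simp add: f laurent_of_poly_pCons algebra_simps laurent_of_poly_minus flip: laurent_x_add mult.assoc)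
  have "\<exists>g. laurent_of_poly f dvd laurent_x (- int k) * laurent_of_poly g' - laurent_of_poly g" for k g'
  proof (induction k)
    case 0
    have "laurent_of_poly f dvd laurent_x (- int 0) * laurent_of_poly g' - laurent_of_poly g'"
      by simp
    then show ?case by blast
  next
    case (Suc k)
    then obtain g where g: "laurent_of_poly f dvd laurent_x (- int k) * laurent_of_poly g' - laurent_of_poly g"
      by blast
    have "laurent_x (- int (Suc k)) * laurent_of_poly g' - laurent_of_poly (- h * g)
      = laurent_x (- 1) * (laurent_x (- int k) * laurent_of_poly g' - laurent_of_poly g)
        + (laurent_x (- 1) - laurent_of_poly (- h)) * laurent_of_poly g"
      using laurent_x_add[of "-1" "- int k", where ?'a = 'p]
      by (simp add: algebra_simps laurent_of_poly_mult laurent_of_poly_minus)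
    with g have "laurent_of_poly f dvd laurent_x (- int (Suc k)) * laurent_of_poly g' - laurent_of_poly (- h * g)"
      by (simp add: x)
    then show ?case by blast
  qed
  moreover obtain k g' where g': "laurent_x (int k) * a = laurent_of_poly g'"
    by (rule laurent_shift_poly)
  moreover have "a = laurent_x (- int k) * laurent_of_poly g'"
    by (simp flip: g' mult.assoc laurent_x_add)
  ultimately show ?thesis using that by metis
qed

section \<open>Maximal submodules\<close>

text \<open>
  A locale of its own: \<open>Modules.module\<close> is already interpreted for real vector spaces, and an
  unqualified constant defined inside it would denote the real instance.
\<close>

locale submodules = Modules.module scale
  for scale :: "'a::comm_ring_1 \<Rightarrow> 'b::ab_group_add \<Rightarrow> 'b"
begin

definition maximal_subspace :: "'b set \<Rightarrow> bool" where
  "maximal_subspace U \<longleftrightarrow> subspace U \<and> U \<noteq> UNIV \<and>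
    (\<forall>W. subspace W \<longrightarrow> U \<subseteq> W \<longrightarrow> W = U \<or> W = UNIV)"

lemma coset_eq_iff:
  assumes "subspace U"
  shows "v +o U = w +o U \<longleftrightarrow> v - w \<in> U"
proof
  assume "v +o U = w +o U"
  moreover have "v \<in> v +o U"
    using subspace_0[OF assms] set_plus_intro2[of 0 U v] by simp
  ultimately show "v - w \<in> U"
    by (simp add: set_minus_plus)
next
  assume *: "v - w \<in> U"
  have "u - v \<in> U \<longleftrightarrow> u - w \<in> U" for u
    using subspace_add[OF assms, of "u - v" "v - w"] subspace_diff[OF assms, of "u - w" "v - w"] *
    by auto
  then show "v +o U = w +o U"
    by (auto simp flip: set_minus_plus)
qed

lemma coset_add:
  assumes "subspace U"
  shows "(v +o U) + (w +o U) = (v + w) +o U"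
proof -
  have "U + U = U"
    using subspace_add[OF assms] set_zero_plus2[OF subspace_0[OF assms], of U]
    by (auto elim!: set_plus_elim)
  then show ?thesis
    by (simp add: set_plus_rearrange)
qed

lemma coset_scale_coset:
  assumes "subspace U"
  shows "coset_scale scale U c (v +o U) = scale c v +o U"
proof -
  have "u - scale c v \<in> U" if "u \<in> scale c ` (v +o U) + U" for u
  proof -
    from that obtain a b where "a \<in> U" "b \<in> U" "u = scale c (v + a) + b"
      by (auto simp: set_plus_def elt_set_plus_def)
    then show ?thesis
      using subspace_add[OF assms subspace_scale[OF assms]] by (simp add: scale_right_distrib)
  qed
  moreover have "u \<in> scale c ` (v +o U) + U" if "u - scale c v \<in> U" for u
  proof -
    have "scale c v \<in> scale c ` (v +o U)"
      using subspace_0[OF assms] set_plus_intro2[of 0 U v] by auto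
    from set_plus_intro[OF this that] show ?thesis by simp
  qed
  ultimately show ?thesis
    by (auto simp: coset_scale_def simp flip: set_minus_plus)
qed

text \<open>The set \<open>?W\<close> below is \<open>U + R v\<close>, a submodule strictly larger
  than \<open>U\<close>, hence everything. This is how simplicity of the quotient gets used.\<close>

lemma maximal_subspace_generate:
  assumes U: "maximal_subspace U" and "v \<notin> U"
  obtains c where "w - scale c v \<in> U"
proof -
  have U': "subspace U" using U by (simp add: maximal_subspace_def)
  let ?W = "{w. \<exists>c. w - scale c v \<in> U}"
  have "subspace ?W"
  proof (rule subspaceI)
    show "0 \<in> ?W"
      using subspace_0[OF U'] by (auto intro!: exI[of _ 0])
  next
    fix x y assume "x \<in> ?W" "y \<in> ?W"
    then obtain c d where "x - scale c v \<in> U" "y - scale d v \<in> U" by blast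
    from subspace_add[OF U' this] have "(x + y) - scale (c + d) v \<in> U"
      by (simp add: algebra_simps)
    then show "x + y \<in> ?W" by blast
  next
    fix x b assume "x \<in> ?W"
    then obtain c where "x - scale c v \<in> U" by blast
    from subspace_scale[OF U' this, of b] have "scale b x - scale (b * c) v \<in> U"
      by (simp add: algebra_simps)
    then show "scale b x \<in> ?W" by blast
  qed
  moreover have "U \<subseteq> ?W"
    by (auto intro!: exI[of _ 0])
  moreover have "v \<in> ?W"
    using subspace_0[OF U'] by (auto intro!: exI[of _ 1])
  ultimately have "?W = UNIV"
    using U \<open>v \<notin> U\<close> unfolding maximal_subspace_def by blast
  with that show ?thesis by blast
qed

end

interpretation laurent_ideal: submodules "(*) :: 'p::prime_card laurent \<Rightarrow> 'p laurent \<Rightarrow> 'p laurent"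
  by unfold_locales (simp_all only: distrib_left distrib_right mult.assoc mult_1_left)

interpretation laurent_vec: submodules
  "(*s) :: 'p::prime_card laurent \<Rightarrow> ('p, 'n::finite) base \<Rightarrow> ('p, 'n) base"
  by unfold_locales
    (simp_all only: vector_add_ldistrib vector_sadd_rdistrib vector_smult_assoc vector_smult_lid)

section \<open>Maximal ideals of the Laurent polynomial ring\<close>

text \<open>Condition \<open>inv\<close> makes the quotient by \<open>I\<close> a field. A nonzero
  polynomial of least degree in \<open>I\<close>, scaled to constant term 1, generates the
  polynomials in \<open>I\<close> by division with remainder, and then \<open>I\<close> itself
  because powers of \<open>x\<close> are units.\<close>

lemma maximal_laurent_ideal:
  fixes I :: "'p::prime_card laurent set"
  assumes I: "laurent_ideal.subspace I" and one: "1 \<notin> I"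
    and inv: "\<And>a. a \<notin> I \<Longrightarrow> \<exists>b. b * a - 1 \<in> I"
  obtains f where "Factorial_Ring.irreducible f" "poly f 0 = 1" "I = {a. laurent_of_poly f dvd a}"
proof -
  note I_diff = laurent_ideal.subspace_diff[OF I]
    and I_scale = laurent_ideal.subspace_scale[OF I]
  have I_scale': "a \<in> I \<Longrightarrow> a * b \<in> I" for a b
    using I_scale[of a b] by (simp add: mult.commute)
  have I_x: "laurent_x s * a \<in> I \<longleftrightarrow> a \<in> I" for s a
  proof
    assume "laurent_x s * a \<in> I"
    from I_scale[OF this, of "laurent_x (- s)"] show "a \<in> I"
      by (simp flip: mult.assoc laurent_x_add)
  qed (rule I_scale)
  define J where "J = {g. laurent_of_poly g \<in> I}"
  \<comment> \<open>This excludes the zero ideal. If \<open>1 - x\<close> lies outside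
    \<open>I\<close>, clearing denominators in its inverse modulo \<open>I\<close> gives
    \<open>h (1 - x) - x^k\<close> in \<open>J\<close>, whose value at 1 is -1.\<close>
  have "\<exists>g. g \<in> J \<and> g \<noteq> 0"
  proof (cases "laurent_of_poly [:1, - 1:] \<in> I")
    case False
    then obtain b where b: "b * laurent_of_poly [:1, - 1:] - 1 \<in> I"
      using inv by blast
    obtain k h where h: "laurent_x (int k) * b = laurent_of_poly h" by (rule laurent_shift_poly)
    have *: "laurent_x (int k) * (b * laurent_of_poly [:1, - 1:] - 1)
      = laurent_of_poly (h * [:1, - 1:] - monom 1 k)"
      by (simp only: right_diff_distrib laurent_of_poly_diff laurent_of_poly_mult flip: h mult.assoc)
        (simp add: laurent_x_eq_of_poly)
    with b have "h * [:1, - 1:] - monom 1 k \<in> J"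
      unfolding J_def mem_Collect_eq by (simp only: I_x flip: *)
    moreover have "h * [:1, - 1:] - monom 1 k \<noteq> 0"
    proof
      assume "h * [:1, - 1:] - monom 1 k = 0"
      from arg_cong[OF this, of "\<lambda>u. poly u 1"] show False
        by (simp add: poly_monom)
    qed
    ultimately show ?thesis by blast
  next
    case True
    then show ?thesis by (intro exI[of _ "[:1, - 1:]"]) (simp add: J_def)
  qed
  then obtain g\<^sub>0 where "g\<^sub>0 \<in> J \<and> g\<^sub>0 \<noteq> 0" ..
  from ex_has_least_nat[of "\<lambda>h. h \<in> J \<and> h \<noteq> 0" g\<^sub>0 degree, OF this]
  obtain g where g: "g \<in> J" "g \<noteq> 0"
    and g_min: "\<And>h. h \<in> J \<Longrightarrow> h \<noteq> 0 \<Longrightarrow> degree g \<le> degree h"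
    by (elim exE conjE) (rule that, blast+)
  \<comment> \<open>Otherwise dividing by the unit \<open>x\<close> would give an element of
    \<open>J\<close> of smaller degree.\<close>
  have "poly g 0 \<noteq> 0"
  proof
    assume "poly g 0 = 0"
    then obtain h where h: "g = pCons 0 h" 
      by (cases g) auto
    then have "h \<in> J"
      using g(1) by (simp add: J_def laurent_of_poly_pCons I_x)
    moreover have "h \<noteq> 0" "degree h < degree g"
      using g(2) h by auto
    ultimately show False
      using g_min by fastforce
  qed
  define f where "f = smult (inverse (poly g 0)) g"
  have f0: "poly f 0 = 1"
    using \<open>poly g 0 \<noteq> 0\<close> by (simp add: f_def)
  then have f_nz: "f \<noteq> 0" by auto
  have fJ: "f \<in> J"
    using g(1) I_scale by (auto simp: f_def J_def laurent_of_poly_smult)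
  have f_min: "degree f \<le> degree h" if "h \<in> J" "h \<noteq> 0" for h
    using g_min[OF that] by (simp add: f_def)
  have J_dvd: "f dvd h" if "h \<in> J" for h
  proof -
    have "h mod f = h - f * (h div f)"
      by (simp add: minus_mult_div_eq_mod)
    then have "h mod f \<in> J"
      using that fJ I_diff I_scale' by (simp add: J_def laurent_of_poly_diff laurent_of_poly_mult)
    then have "h mod f = 0"
      using f_min degree_mod_less'[OF f_nz] by (meson leD)
    then show ?thesis by auto
  qed
  have I_eq: "I = {a. laurent_of_poly f dvd a}"
  proof (intro Set.set_eqI iffI CollectI)
    fix a assume a: "a \<in> I"
    obtain k h where h: "laurent_x (int k) * a = laurent_of_poly h" by (rule laurent_shift_poly)
    with I_scale[OF a, of "laurent_x (int k)"] have "h \<in> J"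
      by (simp add: J_def)
    then have "laurent_of_poly f dvd laurent_of_poly h"
      using J_dvd f0 by (simp add: laurent_of_poly_dvd_iff)
    moreover have "a = laurent_x (- int k) * laurent_of_poly h"
      by (simp flip: h mult.assoc laurent_x_add)
    ultimately show "laurent_of_poly f dvd a"
      by simp
  next
    fix a assume "a \<in> {a. laurent_of_poly f dvd a}"
    then show "a \<in> I"
      using fJ I_scale' by (auto simp: J_def elim!: dvdE)
  qed
  have "Factorial_Ring.irreducible f"
  proof (rule irreducibleI)
    show "\<not> is_unit f"
      using one f0 laurent_of_poly_dvd_iff[of f 1] by (simp add: I_eq)
    fix u v assume uv: "f = u * v"
    \<comment> \<open>If a factor \<open>v\<close> lies in \<open>J\<close>, then \<open>f\<close>
      divides it, and cancelling \<open>v\<close> leaves a unit.\<close>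
    have cons: "is_unit u" if "v \<in> J" "f = u * v" for u v
    proof -
      have "f dvd v" using J_dvd that by blast
      then have "u * v dvd 1 * v" using that by simp
      moreover have "v \<noteq> 0" using that f_nz by auto
      ultimately show ?thesis
        unfolding dvd_mult_cancel_right by simp
    qed
    \<comment> \<open>\<open>I\<close> is prime: if \<open>b\<close> inverts \<open>v\<close> modulo
      \<open>I\<close>, then \<open>u = b (u v) - (b v - 1) u\<close> lies in
      \<open>I\<close>.\<close>
    have "u \<in> J \<or> v \<in> J"
    proof (rule disjCI)
      assume "v \<notin> J"
      then obtain b where b: "b * laurent_of_poly v - 1 \<in> I"
        using inv by (auto simp: J_def)
      have "b * laurent_of_poly f - (b * laurent_of_poly v - 1) * laurent_of_poly u \<in> I"
        using I_diff[OF I_scale I_scale'[OF b]] fJ by (simp add: J_def)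
      moreover have *: "b * (x * y) - (b * y - 1) * x = x" for x y b :: "'r::comm_ring_1"
        by (simp add: algebra_simps)
      ultimately have "laurent_of_poly u \<in> I"
        unfolding uv laurent_of_poly_mult * by blast
      then show "u \<in> J" by (simp add: J_def)
    qed
    then show "is_unit u \<or> is_unit v"
      using cons[OF _ uv] cons[OF _ uv[unfolded mult.commute[of u v]]] by blast
  qed (rule f_nz)
  with f0 I_eq that show ?thesis by blast
qed

lemma card_poly_degree_less:
  "card {g :: 'p::prime_card mod_ring poly. g = 0 \<or> degree g < d} = CARD('p) ^ d"
proof (induction d)
  case (Suc d)
  have "{g :: 'p mod_ring poly. g = 0 \<or> degree g < Suc d}
      = (\<lambda>(c, g). pCons c g) ` (UNIV \<times> {g. g = 0 \<or> degree g < d})" (is "?L = ?R")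
  proof (intro Set.set_eqI iffI)
    fix g assume g: "g \<in> ?L"
    obtain c h where "g = pCons c h" by (cases g)
    with g show "g \<in> ?R"
      by (auto simp: degree_pCons_eq_if image_iff split: if_splits)
  qed (auto simp: degree_pCons_eq_if split: if_splits)
  moreover have "inj_on (\<lambda>(c, g). pCons c g) (UNIV \<times> {g :: 'p mod_ring poly. g = 0 \<or> degree g < d})"
    by (auto simp: inj_on_def)
  ultimately show ?case
    by (simp add: card_image card_cartesian_product Suc)
qed simp

lemma subspace_principal: "laurent_ideal.subspace (range ((*) (a :: 'p::prime_card laurent)))"
proof (rule laurent_ideal.subspaceI)
  show "0 \<in> range ((*) a)" by (metis mult_zero_right rangeI)
  show "x + y \<in> range ((*) a)" if "x \<in> range ((*) a)" "y \<in> range ((*) a)" for x y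
    using that by (auto simp flip: distrib_left)
  show "c * x \<in> range ((*) a)" if "x \<in> range ((*) a)" for c x
    using that by (auto simp: mult.left_commute[of c a])
qed

lemma mem_principal_iff: "x \<in> range ((*) a) \<longleftrightarrow> a dvd x"
  by (auto simp: dvd_def)

section \<open>Simple quotient modules: annihilator, determinant and size\<close>

text \<open>By \<open>ann_iff\<close> all nonzero classes of the quotient share the annihilator
  \<open>f R\<close>. Since any one of them generates it, the quotient is
  \<open>R / f R\<close>.\<close>

locale maximal_submodule =
  fixes U :: "('p::prime_card, 'n::finite) base set" and f :: "'p mod_ring poly"
  assumes maximal: "laurent_vec.maximal_subspace U"
    and irred: "Factorial_Ring.irreducible f" and f_0: "poly f 0 = 1"
    and ann_iff: "w \<notin> U \<Longrightarrow> a *s w \<in> U \<longleftrightarrow> laurent_of_poly f dvd a"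

text \<open>The annihilator \<open>?I\<close> of one nonzero class \<open>e\<close> is a maximal
  ideal: if \<open>a e\<close> is nonzero in the quotient it generates \<open>e\<close> again, which
  inverts \<open>a\<close> modulo \<open>?I\<close>.\<close>

lemma maximal_submodule_exists:
  fixes U :: "('p::prime_card, 'n::finite) base set"
  assumes U: "laurent_vec.maximal_subspace U"
  obtains f where "maximal_submodule U f"
proof -
  have U': "laurent_vec.subspace U" and "U \<noteq> UNIV"
    using U by (auto simp: laurent_vec.maximal_subspace_def)
  note U_add = laurent_vec.subspace_add[OF U'] and U_scale = laurent_vec.subspace_scale[OF U']
  obtain e where e: "e \<notin> U" using \<open>U \<noteq> UNIV\<close> by blast
  let ?I = "{a. a *s e \<in> U}"
  have "laurent_ideal.subspace ?I"
  proof (rule laurent_ideal.subspaceI)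
    show "0 \<in> ?I"
      using laurent_vec.subspace_0[OF U'] by simp
    show "a + b \<in> ?I" if "a \<in> ?I" "b \<in> ?I" for a b
      using U_add[of "a *s e" "b *s e"] that by (simp add: laurent_vec.scale_left_distrib)
    show "c * a \<in> ?I" if "a \<in> ?I" for c a
      using U_scale[of "a *s e" c] that by simp
  qed
  moreover have "1 \<notin> ?I" using e by simp
  moreover have "\<exists>b. b * a - 1 \<in> ?I" if "a \<notin> ?I" for a
  proof -
    from that have "a *s e \<notin> U" by simp
    then obtain b where "e - b *s (a *s e) \<in> U"
      by (rule laurent_vec.maximal_subspace_generate[OF U])
    from laurent_vec.subspace_neg[OF U' this] have "b * a - 1 \<in> ?I"
      by (simp add: laurent_vec.scale_left_diff_distrib)
    then show ?thesis by blast
  qed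
  ultimately obtain f where f: "Factorial_Ring.irreducible f" "poly f 0 = 1"
    and I_eq: "?I = {a. laurent_of_poly f dvd a}"
    by (rule maximal_laurent_ideal)
  \<comment> \<open>Every class is a multiple of \<open>v\<close>, so whatever kills
    \<open>v\<close> kills all; hence the annihilator does not depend on the choice of
    \<open>e\<close>.\<close>
  have ann: "a *s w \<in> U" if "a *s v \<in> U" "v \<notin> U" for a v w
  proof -
    from \<open>v \<notin> U\<close> obtain c where "w - c *s v \<in> U"
      by (rule laurent_vec.maximal_subspace_generate[OF U])
    from U_add[OF U_scale[OF this, of a] U_scale[OF \<open>a *s v \<in> U\<close>, of c]] show ?thesis
      by (simp add: algebra_simps vector_ssub_ldistrib)
  qed
  have "a *s w \<in> U \<longleftrightarrow> laurent_of_poly f dvd a" if "w \<notin> U" for a w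
    using ann[OF _ that, of a e] ann[OF _ e, of a w] I_eq by blast
  with U f have "maximal_submodule U f"
    by (rule maximal_submodule.intro)
  then show ?thesis by (rule that)
qed

context maximal_submodule
begin

lemma subspace: "laurent_vec.subspace U" and proper: "U \<noteq> UNIV"
  using maximal by (auto simp: laurent_vec.maximal_subspace_def)

lemma ann: "laurent_of_poly f dvd a \<Longrightarrow> a *s w \<in> U"
  using ann_iff[of w a] laurent_vec.subspace_scale[OF subspace] by blast

lemma f_nonzero: "f \<noteq> 0"
  using f_0 by auto

lemma coset_eq_U_iff: "v +o U = U \<longleftrightarrow> v \<in> U"
  using laurent_vec.coset_eq_iff[OF subspace, of v 0] by simp

lemma nonunit: "\<not> laurent_of_poly f dvd 1"
  using laurent_of_poly_dvd_iff[of f 1] f_0 irred by (auto simp: irreducible_def)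

lemma cyclic_decomposition_single: "cyclic_decomposition U 1 (\<lambda>_. f) (\<lambda>_. 1)"
proof -
  obtain e where e: "e \<notin> U" using proper by blast
  let ?A = "range ((*) (laurent_of_poly f))"
  \<comment> \<open>The inverse of the isomorphism from \<open>R / f R\<close> induced by
    \<open>c\<close> going to \<open>c e\<close>, written without choosing \<open>c\<close>: the
    multipliers that bring \<open>e\<close> into a coset \<open>C\<close> themselves form a coset of
    \<open>f R\<close>.\<close>
  let ?h = "\<lambda>C. \<lambda>i\<in>{..<1::nat}. {a. a *s e \<in> C}"
  have h: "?h ((c *s e) +o U) = (\<lambda>i\<in>{..<1}. c +o ?A)" for c
  proof -
    have "a *s e \<in> (c *s e) +o U \<longleftrightarrow> a \<in> c +o ?A" for a
      using ann_iff[OF e, of "a - c"]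
      by (simp add: mem_principal_iff laurent_vec.scale_left_diff_distrib flip: set_minus_plus)
    then show ?thesis by auto
  qed
  have cosets_U: "cosets U = range (\<lambda>c. (c *s e) +o U)"
  proof -
    have "v +o U \<in> range (\<lambda>c. (c *s e) +o U)" for v
    proof -
      obtain c where "v - c *s e \<in> U"
        by (rule laurent_vec.maximal_subspace_generate[OF maximal e])
      then show ?thesis
        using laurent_vec.coset_eq_iff[OF subspace] by blast
    qed
    then show ?thesis by (auto simp: cosets_def)
  qed
  have bij: "bij_betw ?h (cosets U) (\<Pi>\<^sub>E i\<in>{..<1}. cosets ?A)"
  proof (rule bij_betw_imageI)
    show "inj_on ?h (cosets U)"
    proof (rule inj_onI)
      fix C D assume "C \<in> cosets U" "D \<in> cosets U" and eq: "?h C = ?h D"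
      then obtain c d where C: "C = (c *s e) +o U" and D: "D = (d *s e) +o U"
        by (auto simp: cosets_U)
      from fun_cong[OF eq[unfolded C D h], of 0] have "laurent_of_poly f dvd c - d"
        by (simp add: laurent_ideal.coset_eq_iff[OF subspace_principal] mem_principal_iff)
      then show "C = D"
        using ann_iff[OF e, of "c - d"]
        by (simp add: C D laurent_vec.coset_eq_iff[OF subspace] laurent_vec.scale_left_diff_distrib)
    qed
    show "?h ` cosets U = (\<Pi>\<^sub>E i\<in>{..<1}. cosets ?A)"
    proof (intro equalityI subsetI)
      fix X assume "X \<in> ?h ` cosets U"
      then obtain c where "X = ?h ((c *s e) +o U)"
        by (auto simp: cosets_U)
      then show "X \<in> (\<Pi>\<^sub>E i\<in>{..<1}. cosets ?A)"
        unfolding h by (auto simp: cosets_def)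
    next
      fix X assume X: "X \<in> (\<Pi>\<^sub>E i\<in>{..<1::nat}. cosets ?A)"
      then have "X 0 \<in> cosets ?A" by auto
      then obtain c where "X 0 = c +o ?A" by (auto simp: cosets_def)
      with X have "X = ?h ((c *s e) +o U)"
        unfolding h by (intro PiE_ext[OF X]) (auto simp: cosets_def)
      then show "X \<in> ?h ` cosets U"
        by (auto simp: cosets_U)
    qed
  qed
  have add: "?h (C + D) i = ?h C i + ?h D i"
    if "C \<in> cosets U" "D \<in> cosets U" "i < 1" for C D and i :: nat
  proof -
    from that obtain c d where C: "C = (c *s e) +o U" and D: "D = (d *s e) +o U"
      by (auto simp: cosets_U)
    have "C + D = ((c + d) *s e) +o U"
      by (simp add: C D laurent_vec.coset_add[OF subspace] laurent_vec.scale_left_distrib)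
    then show ?thesis
      using that by (simp only: C D h) (simp add: laurent_ideal.coset_add[OF subspace_principal])
  qed
  have scale: "?h (coset_scale (*s) U c C) i = coset_scale (*) ?A c (?h C i)"
    if "C \<in> cosets U" "i < 1" for c C and i :: nat
  proof -
    from that obtain d where C: "C = (d *s e) +o U"
      by (auto simp: cosets_U)
    have "coset_scale (*s) U c C = ((c * d) *s e) +o U"
      by (simp add: C laurent_vec.coset_scale_coset[OF subspace])
    then show ?thesis
      using that by (simp only: C h) (simp add: laurent_ideal.coset_scale_coset[OF subspace_principal])
  qed
  have "quotient_iso U 1 (\<lambda>i. laurent_of_poly f ^ 1)"
    unfolding quotient_iso_def power_one_right
    by (intro exI[of _ ?h] conjI allI impI ballI bij add scale)
  then show ?thesis
    using irred f_0 by (simp add: cyclic_decomposition_def)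
qed

text \<open>Both sides of the first claim say that \<open>c\<close> annihilates the quotient. For
  the second, no summands would make the quotient trivial, and two nonzero summands would contradict
  simplicity.\<close>

lemma quotient_iso_dvd_iff:
  assumes "quotient_iso U m a"
  shows "laurent_of_poly f dvd c \<longleftrightarrow> (\<forall>i<m. a i dvd c)"
    and "\<forall>i<m. \<not> a i dvd 1 \<Longrightarrow> m = 1"
proof -
  define A where "A i = range ((*) (a i))" for i
  have A: "laurent_ideal.subspace (A i)" for i
    unfolding A_def by (rule subspace_principal)
  have A_iff: "x +o A i = y +o A i \<longleftrightarrow> a i dvd x - y" for x y i
    by (simp add: laurent_ideal.coset_eq_iff[OF A]) (simp add: A_def mem_principal_iff)
  from assms obtain h where
    bij: "bij_betw h (cosets U) (\<Pi>\<^sub>E i\<in>{..<m}. cosets (A i))"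
    and scale: "\<And>c C i. C \<in> cosets U \<Longrightarrow> i < m \<Longrightarrow>
      h (coset_scale (*s) U c C) i = coset_scale (*) (A i) c (h C i)"
    unfolding quotient_iso_def A_def by blast
  have coset: "v +o U \<in> cosets U" for v by (simp add: cosets_def)
  have h_scale: "h ((c *s v) +o U) i = (c * x) +o A i" if "i < m" "h (v +o U) i = x +o A i" for c v x i
    using scale[OF coset[of v] \<open>i < m\<close>, of c] that
    by (simp add: laurent_vec.coset_scale_coset[OF subspace] laurent_ideal.coset_scale_coset[OF A])
  have h_coset: "\<exists>x. h (v +o U) i = x +o A i" if "i < m" for v i
    using bij_betw_apply[OF bij coset[of v]] that by (auto simp: cosets_def PiE_iff)
  have h_U: "h U i = 0 +o A i" if i: "i < m" for i
  proof -
    \<comment> \<open>The zero class is fixed by scaling with 0, and so must be its image.\<close>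
    obtain x where "h (0 +o U) i = x +o A i" using h_coset[OF i] by blast
    from h_scale[OF i this, of 0] show ?thesis by simp
  qed
  have surj: "\<exists>v. \<forall>i<m. h (v +o U) i = x i +o A i" for x
  proof -
    have "(\<lambda>i\<in>{..<m}. x i +o A i) \<in> h ` cosets U"
      using bij_betw_imp_surj_on[OF bij] by (auto simp: cosets_def)
    then obtain v where "h (v +o U) = (\<lambda>i\<in>{..<m}. x i +o A i)"
      by (auto simp: cosets_def)
    then have "\<forall>i<m. h (v +o U) i = x i +o A i" by simp
    then show ?thesis ..
  qed
  show "laurent_of_poly f dvd c \<longleftrightarrow> (\<forall>i<m. a i dvd c)"
  proof (intro iffI allI impI)
    fix i assume c: "laurent_of_poly f dvd c" and i: "i < m"
    \<comment> \<open>A vector that is 1 in every coordinate: killing it means that \<open>c\<close>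
      is zero in each summand.\<close>
    obtain v where v: "\<forall>i<m. h (v +o U) i = 1 +o A i" using surj[of "\<lambda>_. 1"] by blast
    have "(c *s v) +o U = U"
      using ann[OF c] by (simp add: coset_eq_U_iff)
    with h_scale[OF i, of v 1 c] h_U[OF i] v i have "(c * 1) +o A i = 0 +o A i"
      by simp
    then show "a i dvd c"
      by (simp only: A_iff) simp
  next
    assume c: "\<forall>i<m. a i dvd c"
    obtain e where e: "e \<notin> U" using proper by blast
    have "h ((c *s e) +o U) = h U"
    proof (rule PiE_ext)
      show "h ((c *s e) +o U) \<in> (\<Pi>\<^sub>E i\<in>{..<m}. cosets (A i))"
        by (rule bij_betw_apply[OF bij coset])
      show "h U \<in> (\<Pi>\<^sub>E i\<in>{..<m}. cosets (A i))"
        using bij_betw_apply[OF bij coset[of 0]] by simp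
      fix i assume "i \<in> {..<m}"
      then have i: "i < m" by simp
      obtain x where "h (e +o U) i = x +o A i" using h_coset[OF i] by blast
      from h_scale[OF i this, of c] c i have "h ((c *s e) +o U) i = 0 +o A i"
        by (simp only: A_iff) simp
      then show "h ((c *s e) +o U) i = h U i"
        by (simp only: h_U[OF i])
    qed
    then have "(c *s e) +o U = U"
      using inj_onD[OF bij_betw_imp_inj_on[OF bij] _ coset coset[of 0]] by simp
    then show "laurent_of_poly f dvd c"
      using ann_iff[OF e] by (simp add: coset_eq_U_iff)
  qed
  show "m = 1" if nonunits: "\<forall>i<m. \<not> a i dvd 1"
  proof (rule ccontr)
    assume "m \<noteq> 1"
    show False
    proof (cases "m = 0")
      case True
      obtain e where "e \<notin> U" using proper by blast
      \<comment> \<open>The empty extensional product has just one element, so \<open>h\<close>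
        would identify two distinct cosets.\<close>
      have "h U = h (e +o U)"
        using True bij_betw_apply[OF bij coset[of 0]] bij_betw_apply[OF bij coset[of e]] by simp
      then have "e +o U = U"
        using inj_onD[OF bij_betw_imp_inj_on[OF bij] _ coset coset[of 0]] by simp
      with \<open>e \<notin> U\<close> show False by (simp add: coset_eq_U_iff)
    next
      case False
      with \<open>m \<noteq> 1\<close> have m: "0 < m" "1 < m" by auto
      \<comment> \<open>The unit vectors \<open>v\<close> and \<open>w\<close> of the first two
        summands: \<open>v\<close> is nonzero, hence generates \<open>w\<close>, yet coordinate 1 of
        any multiple of \<open>v\<close> is zero.\<close>
      obtain v where v: "\<forall>i<m. h (v +o U) i = (if i = 0 then 1 else 0) +o A i"
        using surj[of "\<lambda>i. if i = 0 then 1 else 0"] by blast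
      obtain w where w: "\<forall>i<m. h (w +o U) i = (if i = 1 then 1 else 0) +o A i"
        using surj[of "\<lambda>i. if i = 1 then 1 else 0"] by blast
      have "v \<notin> U"
      proof
        assume "v \<in> U"
        then have "v +o U = U" by (simp add: coset_eq_U_iff)
        with v h_U[OF m(1)] m(1) have "1 +o A 0 = 0 +o A 0" by metis
        then have "a 0 dvd 1" by (simp only: A_iff) simp
        with nonunits m show False by blast
      qed
      then obtain c where "w - c *s v \<in> U"
        by (rule laurent_vec.maximal_subspace_generate[OF maximal])
      then have "w +o U = (c *s v) +o U"
        by (simp add: laurent_vec.coset_eq_iff[OF subspace])
      moreover have "h (v +o U) 1 = 0 +o A 1" using v m(2) by simp
      moreover have "h (w +o U) 1 = 1 +o A 1" using w m(2) by simp
      ultimately have "1 +o A 1 = (c * 0) +o A 1"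
        using h_scale[OF m(2), of v 0 c] by metis
      then have "a 1 dvd 1" by (simp only: A_iff) simp
      with nonunits m show False by blast
    qed
  qed
qed

text \<open>No summand is trivial, a free one included since \<open>r i\<close> is positive and so
  \<open>0 ^ r i = 0\<close>; hence there is just one. Comparing annihilators, \<open>f\<close> and
  \<open>q 0 ^ r 0\<close> divide each other, and constant terms 1 make them equal.\<close>

lemma cyclic_decomposition_prod:
  assumes "cyclic_decomposition U m q r"
  shows "(\<Prod>i\<in>{i. i < m \<and> q i \<noteq> 0}. q i ^ r i) = f"
proof -
  have iso: "quotient_iso U m (\<lambda>i. laurent_of_poly (q i) ^ r i)"
    and r: "i < m \<Longrightarrow> 1 \<le> r i"
    and q: "i < m \<Longrightarrow> q i = 0 \<or> Factorial_Ring.irreducible (q i) \<and> poly (q i) 0 = 1" for i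
    using assms by (auto simp: cyclic_decomposition_def)
  have "\<not> laurent_of_poly (q i) ^ r i dvd 1" if i: "i < m" for i
  proof (cases "q i = 0")
    case False
    then have "\<not> laurent_of_poly (q i) dvd 1"
      using q[OF i] laurent_of_poly_dvd_iff[of "q i" 1] by (auto simp: irreducible_def)
    then show ?thesis
      using dvd_trans[OF dvd_power[of "r i" "laurent_of_poly (q i)"]] r[OF i] by auto
  qed (use r[OF i] in \<open>simp add: power_0_left\<close>)
  then have m: "m = 1"
    using quotient_iso_dvd_iff(2)[OF iso] by blast
  define g where "g = q 0 ^ r 0"
  have dvd: "laurent_of_poly f dvd c \<longleftrightarrow> laurent_of_poly g dvd c" for c
    using quotient_iso_dvd_iff(1)[OF iso, of c] by (simp add: m g_def laurent_of_poly_power)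
  have q0: "q 0 \<noteq> 0"
  proof
    assume "q 0 = 0"
    then have "g = 0" using r[of 0] m by (simp add: g_def power_0_left)
    with dvd[of "laurent_of_poly f"] f_nonzero show False
      using laurent_of_poly_eq_iff[of f 0] by simp
  qed
  then have g_0: "poly g 0 = 1" using q[of 0] m by (simp add: g_def)
  have "f dvd g" "g dvd f"
    using dvd[of "laurent_of_poly f"] dvd[of "laurent_of_poly g"] f_0 g_0
    by (simp_all add: laurent_of_poly_dvd_iff)
  from \<open>f dvd g\<close> obtain u where u: "g = f * u" ..
  have "is_unit u"
    using \<open>g dvd f\<close> f_nonzero dvd_times_left_cancel_iff[of f u 1] by (simp add: u)
  then have "degree u = 0" by auto
  then obtain c where "u = [:c:]" by (rule degree_eq_zeroE)
  with u(1) f_0 g_0 have "g = f"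
    by (simp add: one_pCons)
  moreover have "{i. i < m \<and> q i \<noteq> 0} = {0}"
    using q0 m by auto
  ultimately show ?thesis by (simp add: g_def)
qed

lemma det_star_eq: "det_star U = f"
  unfolding det_star_def
proof (rule the_equality)
  show "\<exists>m q r. cyclic_decomposition U m q r \<and> f = (\<Prod>i\<in>{i. i < m \<and> q i \<noteq> 0}. q i ^ r i)"
    by (intro exI conjI) (rule cyclic_decomposition_single,
      rule cyclic_decomposition_prod[OF cyclic_decomposition_single, symmetric])
next
  fix d
  assume "\<exists>m q r. cyclic_decomposition U m q r \<and> d = (\<Prod>i\<in>{i. i < m \<and> q i \<noteq> 0}. q i ^ r i)"
  then obtain m q r where "cyclic_decomposition U m q r"
    and "d = (\<Prod>i\<in>{i. i < m \<and> q i \<noteq> 0}. q i ^ r i)"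
    by (elim exE conjE)
  then show "d = f"
    by (simp only: cyclic_decomposition_prod)
qed

text \<open>Each class is \<open>g e\<close> for a unique remainder \<open>g\<close> modulo
  \<open>f\<close>: a Laurent multiplier of \<open>e\<close> is first made a polynomial, then
  reduced by division.\<close>

lemma card_cosets: "card (cosets U) = CARD('p) ^ degree f"
proof -
  obtain e where e: "e \<notin> U" using proper by blast
  let ?P = "{g :: 'p mod_ring poly. g = 0 \<or> degree g < degree f}"
  have eq_iff: "(laurent_of_poly g *s e) +o U = (laurent_of_poly h *s e) +o U \<longleftrightarrow> f dvd g - h" for g h
  proof -
    have "laurent_of_poly g *s e - laurent_of_poly h *s e = laurent_of_poly (g - h) *s e"
      by (simp only: laurent_of_poly_diff laurent_vec.scale_left_diff_distrib)
    moreover have "laurent_of_poly f dvd laurent_of_poly (g - h) \<longleftrightarrow> f dvd g - h"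
      by (rule laurent_of_poly_dvd_iff) (simp add: f_0)
    ultimately show ?thesis
      by (simp only: laurent_vec.coset_eq_iff[OF subspace] ann_iff[OF e])
  qed
  have "bij_betw (\<lambda>g. (laurent_of_poly g *s e) +o U) ?P (cosets U)"
  proof (rule bij_betw_imageI)
    show "inj_on (\<lambda>g. (laurent_of_poly g *s e) +o U) ?P"
    proof (rule inj_onI)
      fix g h assume gh: "g \<in> ?P" "h \<in> ?P"
        and "(laurent_of_poly g *s e) +o U = (laurent_of_poly h *s e) +o U"
      then have "f dvd g - h" by (simp add: eq_iff)
      moreover have "g - h = 0 \<or> degree (g - h) < degree f"
        using gh degree_diff_less[of g "degree f" h] by auto
      ultimately show "g = h"
        using dvd_imp_degree_le[of f "g - h"] by (cases "g = h") auto
    qed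
    show "(\<lambda>g. (laurent_of_poly g *s e) +o U) ` ?P = cosets U"
    proof (intro equalityI subsetI)
      fix C assume "C \<in> cosets U"
      then obtain v where C: "C = v +o U" by (auto simp: cosets_def)
      obtain c where c: "v - c *s e \<in> U"
        by (rule laurent_vec.maximal_subspace_generate[OF maximal e])
      obtain g where g: "laurent_of_poly f dvd c - laurent_of_poly g"
        using laurent_cong_poly[OF f_0] .
      have "v - laurent_of_poly g *s e \<in> U"
        using laurent_vec.subspace_add[OF subspace c ann[OF g, of e]]
        by (simp add: laurent_vec.scale_left_diff_distrib)
      then have "C = (laurent_of_poly g *s e) +o U"
        by (simp add: C laurent_vec.coset_eq_iff[OF subspace])
      also have "\<dots> = (laurent_of_poly (g mod f) *s e) +o U"
        by (simp add: eq_iff minus_mod_eq_mult_div)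
      finally show "C \<in> (\<lambda>g. (laurent_of_poly g *s e) +o U) ` ?P"
        using degree_mod_less[OF f_nonzero] by blast
    qed (auto simp: cosets_def)
  qed
  from bij_betw_same_card[OF this] show ?thesis
    by (simp only: card_poly_degree_less)
qed

end

section \<open>Subgroups of the wreath product\<close>

lemma (in group) rcoset_eq_iff:
  assumes H: "subgroup H G" and x: "x \<in> carrier G" and y: "y \<in> carrier G"
  shows "H #> x = H #> y \<longleftrightarrow> x \<otimes> inv y \<in> H"
proof -
  have "H #> x = H #> y \<longleftrightarrow> x \<in> H #> y"
    using repr_independence[OF _ y H] rcos_self[OF x H] by auto
  also have "\<dots> \<longleftrightarrow> x \<otimes> inv y \<in> H"
    by (rule subgroup.rcos_module[OF H group_axioms y x])
  finally show ?thesis .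
qed

text \<open>Choosing a preimage under \<open>f\<close> and applying \<open>g\<close> is a bijection
  of the ranges. This serves to compare cosets in the wreath product with cosets in the base
  group.\<close>

lemma card_range_cong:
  assumes "\<And>x y. f x = f y \<longleftrightarrow> g x = g y"
  shows "card (range f) = card (range g)"
proof -
  have "g (inv_into UNIV f (f x)) = g x" for x
    using assms f_inv_into_f[of "f x" f UNIV] by blast
  then have "bij_betw (\<lambda>a. g (inv_into UNIV f a)) (range f) (range g)"
    by (intro bij_betw_imageI) (auto simp: inj_on_def image_image assms)
  then show ?thesis by (rule bij_betw_same_card)
qed

text \<open>The generator is the least positive element, or 0 if there is none; division with
  remainder does the rest.\<close>

lemma int_subgroup_generator:
  fixes S :: "int set"
  assumes zero: "0 \<in> S" and diff: "\<And>x y. x \<in> S \<Longrightarrow> y \<in> S \<Longrightarrow> x - y \<in> S"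
  obtains n :: nat where "S = range ((*) (int n))"
proof (cases "\<exists>k::nat. 0 < k \<and> int k \<in> S")
  case False
  have "x = 0" if "x \<in> S" for x
  proof (rule ccontr)
    assume "x \<noteq> 0"
    moreover have "int (nat \<bar>x\<bar>) \<in> S"
      using that diff[OF zero that] by (auto simp: abs_if)
    ultimately show False using False by (metis zero_less_abs_iff zero_less_nat_eq)
  qed
  with zero have "S = range ((*) (int 0))" by auto
  then show ?thesis by (rule that)
next
  case True
  define n where "n = (LEAST k::nat. 0 < k \<and> int k \<in> S)"
  have n: "0 < n" "int n \<in> S"
    using LeastI_ex[OF True] by (auto simp: n_def)
  have n_min: "n \<le> k" if "0 < k" "int k \<in> S" for k
    unfolding n_def using that by (intro Least_le) auto
  have neg: "x \<in> S \<Longrightarrow> - x \<in> S" for x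
    using diff[OF zero, of x] by simp
  have add: "x \<in> S \<Longrightarrow> y \<in> S \<Longrightarrow> x + y \<in> S" for x y
    using diff[OF _ neg, of x y] by simp
  have mult: "int n * int k \<in> S" for k
    by (induction k) (auto simp: zero distrib_left intro: add n)
  have mult': "int n * k \<in> S" for k
    using mult[of "nat k"] neg[OF mult[of "nat (- k)"]] by (cases "k \<ge> 0") auto
  have "x \<in> range ((*) (int n))" if "x \<in> S" for x
  proof -
    have "x mod int n \<in> S"
      using diff[OF that mult'[of "x div int n"]] by (simp add: minus_mult_div_eq_mod)
    moreover have "0 \<le> x mod int n" "x mod int n < int n"
      using n(1) by auto
    ultimately have "x mod int n = 0"
      using n_min[of "nat (x mod int n)"] by (cases "x mod int n = 0") (simp_all add: le_nat_iff)
    then show ?thesis by (auto elim!: dvdE)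
  qed
  with mult' have "S = range ((*) (int n))" by auto
  then show ?thesis by (rule that)
qed

lemma mult_wreath: "(v, s) \<otimes>\<^bsub>wreath\<^esub> (w, t) = (v + laurent_x s *s w, s + t)"
  by (simp add: wreath_def)

lemma carrier_wreath [simp]: "carrier wreath = UNIV"
  by (simp add: wreath_def)

lemma one_wreath: "\<one>\<^bsub>wreath\<^esub> = (0, 0)"
  by (simp add: wreath_def)

lemma laurent_x_cancel [simp]: "laurent_x s * laurent_x (- s) = 1" "laurent_x (- s) * laurent_x s = 1"
  by (simp_all flip: laurent_x_add)

lemma inv_wreath: "inv\<^bsub>wreath\<^esub> (v, s) = (- (laurent_x (- s) *s v), - s)"
  by (rule group.inv_equality[OF group_wreath]) (simp_all add: mult_wreath one_wreath)

lemma subgroup_wreathD: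
  assumes "subgroup H wreath"
  shows "(0, 0) \<in> H"
    and "(v, s) \<in> H \<Longrightarrow> (w, t) \<in> H \<Longrightarrow> (v + laurent_x s *s w, s + t) \<in> H"
    and "(v, s) \<in> H \<Longrightarrow> (- (laurent_x (- s) *s v), - s) \<in> H"
  using subgroup.one_closed[OF assms] subgroup.m_closed[OF assms, of "(v, s)" "(w, t)"]
    subgroup.m_inv_closed[OF assms, of "(v, s)"]
  by (simp_all add: mult_wreath one_wreath inv_wreath)

lemma subgroup_wreathI:
  assumes "(0, 0) \<in> H"
    and "\<And>v s w t. (v, s) \<in> H \<Longrightarrow> (w, t) \<in> H \<Longrightarrow> (v + laurent_x s *s w, s + t) \<in> H"
    and "\<And>v s. (v, s) \<in> H \<Longrightarrow> (- (laurent_x (- s) *s v), - s) \<in> H"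
  shows "subgroup H wreath"
  using assms by (intro subgroup.intro) (auto simp: mult_wreath one_wreath inv_wreath)

section \<open>Subgroups containing the base group\<close>

lemma mem_base_rtimes_iff: "(v, s) \<in> base_rtimes q \<longleftrightarrow> int q dvd s"
  by (auto simp: base_rtimes_def)

lemma subgroup_base_rtimes: "subgroup (base_rtimes q) wreath"
  by (rule subgroup_wreathI) (auto simp: mem_base_rtimes_iff)

text \<open>Membership depends only on the integer coordinate, which conjugation leaves
  unchanged.\<close>

lemma normal_base_rtimes: "base_rtimes q \<lhd> wreath"
  unfolding group.normal_inv_iff[OF group_wreath]
  using subgroup_base_rtimes by (auto simp: mult_wreath inv_wreath mem_base_rtimes_iff)

lemma card_rcosets_base_rtimes:
  assumes "0 < q"
  shows "card (rcosets\<^bsub>wreath\<^esub> (base_rtimes q :: (('p::prime_card, 'n::finite) base \<times> int) set)) = q"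
proof -
  let ?H = "base_rtimes q :: (('p, 'n) base \<times> int) set"
  let ?c = "\<lambda>g. ?H #>\<^bsub>wreath\<^esub> g"
  have eq_iff: "?c (v, s) = ?c (w, t) \<longleftrightarrow> int q dvd s - t" for v w s t
    by (simp add: group.rcoset_eq_iff[OF group_wreath subgroup_base_rtimes] mult_wreath inv_wreath
        mem_base_rtimes_iff)
  have "bij_betw (\<lambda>i. ?c (0, int i)) {..<q} (rcosets\<^bsub>wreath\<^esub> ?H)"
  proof (rule bij_betw_imageI)
    show "inj_on (\<lambda>i. ?c (0, int i)) {..<q}"
    proof (rule inj_onI)
      fix i j assume "i \<in> {..<q}" "j \<in> {..<q}" "?c (0, int i) = ?c (0, int j)"
      then have "i < q" "j < q" "int q dvd int i - int j"
        by (simp_all add: eq_iff)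
      then show "i = j"
        by (simp flip: mod_eq_dvd_iff of_nat_mod)
    qed
    have "?c (v, s) \<in> (\<lambda>i. ?c (0, int i)) ` {..<q}" for v s
    proof -
      have "?c (v, s) = ?c (0, int (nat (s mod int q)))"
        using assms by (simp add: eq_iff minus_mod_eq_mult_div)
      moreover have "nat (s mod int q) \<in> {..<q}"
        using assms by (simp add: nat_less_iff)
      ultimately show ?thesis by (rule image_eqI)
    qed
    then show "(\<lambda>i. ?c (0, int i)) ` {..<q} = rcosets\<^bsub>wreath\<^esub> ?H"
      by (auto simp: RCOSETS_def)
  qed
  from bij_betw_same_card[OF this] show ?thesis by simp
qed

lemma maximal_subgroup_wreath_cases:
  assumes "maximal_subgroup V wreath"
  obtains (surj) "snd ` V = UNIV" | (base_rtimes) q where "Factorial_Ring.prime q" "V = base_rtimes q"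
proof -
  have V: "subgroup V wreath"
    and max: "\<And>K. subgroup K wreath \<Longrightarrow> V \<subseteq> K \<Longrightarrow> K = V \<or> K = UNIV"
    using assms by (auto simp: maximal_subgroup_def)
  have "0 \<in> snd ` V"
    using subgroup_wreathD(1)[OF V] by force
  moreover have "x - y \<in> snd ` V" if "x \<in> snd ` V" "y \<in> snd ` V" for x y
  proof -
    from that obtain v w where "(v, x) \<in> V" "(w, y) \<in> V" by auto
    from subgroup_wreathD(2)[OF V this(1) subgroup_wreathD(3)[OF V this(2)]] show ?thesis
      by force
  qed
  ultimately obtain n where n: "snd ` V = range ((*) (int n))"
    by (rule int_subgroup_generator)
  show ?thesis
  proof (cases "n = 1")
    case True
    with n surj show ?thesis by simp
  next
    case False
    \<comment> \<open>This includes \<open>n = 0\<close>, where \<open>V\<close> lies in the base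
      group and any prime will do.\<close>
    then obtain q where q: "Factorial_Ring.prime q" "q dvd n"
      using prime_factor_nat by blast
    have "V \<subseteq> base_rtimes q"
    proof
      fix g assume "g \<in> V"
      then have "snd g \<in> range ((*) (int n))"
        using n by blast
      with \<open>q dvd n\<close> have "int q dvd snd g"
        by (auto intro: dvd_mult2)
      then show "g \<in> base_rtimes q"
        by (cases g) (simp add: mem_base_rtimes_iff)
    qed
    moreover have "(0, 1) \<notin> base_rtimes q"
      using \<open>Factorial_Ring.prime q\<close> by (auto simp: mem_base_rtimes_iff)
    ultimately have "V = base_rtimes q"
      using max[OF subgroup_base_rtimes] by blast
    with q(1) base_rtimes show ?thesis by blast
  qed
qed

section \<open>Subgroups that surject onto the integers\<close>

context
  fixes V :: "(('p::prime_card, 'n::finite) base \<times> int) set" and V\<^sub>0 :: "('p, 'n) base set"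
  assumes V: "subgroup V wreath" and surj: "snd ` V = UNIV"
  defines "V\<^sub>0 \<equiv> {w. (w, 0) \<in> V}"
begin

lemma mem_V\<^sub>0: "w \<in> V\<^sub>0 \<longleftrightarrow> (w, 0) \<in> V"
  by (simp add: V\<^sub>0_def)

lemma lift: obtains u where "(u, s) \<in> V"
proof -
  have "s \<in> snd ` V" using surj by simp
  then show ?thesis using that by auto
qed

text \<open>Conjugation by an element of \<open>V\<close> above \<open>s\<close> acts on the base
  group as \<open>x^s\<close>, and scalars of the prime field act by repeated addition; sums of such
  operations give every Laurent polynomial.\<close>

lemma subspace_V\<^sub>0: "laurent_vec.subspace V\<^sub>0"
proof (rule laurent_vec.subspaceI)
  show zero: "0 \<in> V\<^sub>0"
    using subgroup_wreathD(1)[OF V] by (simp add: mem_V\<^sub>0)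
  show add: "v + w \<in> V\<^sub>0" if "v \<in> V\<^sub>0" "w \<in> V\<^sub>0" for v w
    using subgroup_wreathD(2)[OF V, of v 0 w 0] that by (simp add: mem_V\<^sub>0)
  have x: "laurent_x s *s w \<in> V\<^sub>0" if "w \<in> V\<^sub>0" for s w
  proof -
    obtain u where u: "(u, s) \<in> V" by (rule lift)
    have "(u + laurent_x s *s w, s) \<in> V"
      using subgroup_wreathD(2)[OF V u] that[unfolded mem_V\<^sub>0] by fastforce
    from subgroup_wreathD(2)[OF V this subgroup_wreathD(3)[OF V u]] show ?thesis
      by (simp add: mem_V\<^sub>0)
  qed
  have const: "Poly_Mapping.single 0 c *s w \<in> V\<^sub>0" if "w \<in> V\<^sub>0" for c w
  proof -
    obtain k where "c = of_nat k" using surj_of_nat_mod_ring[of c] by blast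
    moreover have "of_nat k *s w \<in> V\<^sub>0" for k
      by (induction k) (simp_all add: zero add that laurent_vec.scale_left_distrib)
    ultimately show ?thesis by simp
  qed
  show "c *s w \<in> V\<^sub>0" if "w \<in> V\<^sub>0" for c w
  proof (induction c rule: update_induct)
    case (update c s a)
    have "Poly_Mapping.update s a c = Poly_Mapping.single 0 a * laurent_x s + c"
      by (simp add: update_eq_single_add[OF update.hyps(1)] laurent_x_def mult_single)
    then have "Poly_Mapping.update s a c *s w = Poly_Mapping.single 0 a *s (laurent_x s *s w) + c *s w"
      by (simp add: laurent_vec.scale_left_distrib)
    then show ?case
      using add[OF const[OF x[OF that]] update.IH] by simp
  qed (simp add: zero)
qed

text \<open>Surjectivity puts an element of the base group into every right coset of
  \<open>V\<close>, and two of them share a coset exactly when they differ by an element of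
  \<open>V\<^sub>0\<close>.\<close>

lemma card_rcosets_eq_card_cosets: "card (rcosets\<^bsub>wreath\<^esub> V) = card (cosets V\<^sub>0)"
proof -
  let ?c = "\<lambda>g. V #>\<^bsub>wreath\<^esub> g"
  have eq_iff: "?c (v, s) = ?c (w, 0) \<longleftrightarrow> (v - laurent_x s *s w, s) \<in> V" for v w s
    by (simp add: group.rcoset_eq_iff[OF group_wreath V] mult_wreath inv_wreath)
  have "?c (v, s) \<in> range (\<lambda>w. ?c (w, 0))" for v s
  proof -
    obtain u where u: "(u, s) \<in> V" by (rule lift)
    \<comment> \<open>The representative \<open>w\<close> solves \<open>v - x^s w = u\<close>, so
      that the quotient of the two elements is \<open>(u, s)\<close>.\<close>
    then have "?c (v, s) = ?c (laurent_x (- s) *s (v - u), 0)"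
      by (simp add: eq_iff)
    then show ?thesis by blast
  qed
  then have "rcosets\<^bsub>wreath\<^esub> V = range (\<lambda>w. ?c (w, 0))"
    by (auto simp: RCOSETS_def)
  then show ?thesis
    unfolding cosets_def
    by (simp add: card_range_cong[of "\<lambda>w. ?c (w, 0)" "\<lambda>w. w +o V\<^sub>0"] eq_iff mem_V\<^sub>0
        laurent_vec.coset_eq_iff[OF subspace_V\<^sub>0])
qed

text \<open>The group \<open>K\<close> below is the product \<open>W V\<close>, and it meets the
  base group in \<open>W\<close>. Hence \<open>K = V\<close> gives \<open>W = V\<^sub>0\<close>, and
  \<open>K = UNIV\<close> gives \<open>W = UNIV\<close>.\<close>

lemma maximal_subspace_V\<^sub>0:
  assumes "maximal_subgroup V wreath"
  shows "laurent_vec.maximal_subspace V\<^sub>0"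
  unfolding laurent_vec.maximal_subspace_def
proof (intro conjI allI impI subspace_V\<^sub>0)
  have proper: "V \<noteq> UNIV" and max: "\<And>K. subgroup K wreath \<Longrightarrow> V \<subseteq> K \<Longrightarrow> K = V \<or> K = UNIV"
    using assms by (auto simp: maximal_subgroup_def)
  show "V\<^sub>0 \<noteq> UNIV"
  proof
    assume "V\<^sub>0 = UNIV"
    have "(v, s) \<in> V" for v s
    proof -
      obtain u where u: "(u, s) \<in> V" by (rule lift)
      moreover have "(v - u, 0) \<in> V"
        using \<open>V\<^sub>0 = UNIV\<close> mem_V\<^sub>0 by blast
      ultimately show ?thesis
        using subgroup_wreathD(2)[OF V, of "v - u" 0 u s] by simp
    qed
    with proper show False by auto
  qed
  fix W assume W: "laurent_vec.subspace W" and "V\<^sub>0 \<subseteq> W"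
  define K where "K = {(w + v, s) |w v s. w \<in> W \<and> (v, s) \<in> V}"
  have KI: "g \<in> K" if "w \<in> W" "(v, s) \<in> V" "g = (w + v, s)" for g w v s
    using that by (auto simp: K_def)
  have "subgroup K wreath"
  proof (rule subgroup_wreathI)
    show "(0, 0) \<in> K"
      by (rule KI[OF laurent_vec.subspace_0[OF W] subgroup_wreathD(1)[OF V]]) simp
  next
    fix g s h t assume "(g, s) \<in> K" "(h, t) \<in> K"
    then obtain w v w' v' where "w \<in> W" "(v, s) \<in> V" "g = w + v" "w' \<in> W" "(v', t) \<in> V" "h = w' + v'"
      by (auto simp: K_def)
    note g = this
    have "w + laurent_x s *s w' \<in> W"
      using g by (intro laurent_vec.subspace_add[OF W] laurent_vec.subspace_scale[OF W])
    moreover have "(v + laurent_x s *s v', s + t) \<in> V"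
      using g by (intro subgroup_wreathD(2)[OF V])
    ultimately show "(g + laurent_x s *s h, s + t) \<in> K"
      by (rule KI) (simp add: g laurent_vec.scale_right_distrib)
  next
    fix g s assume "(g, s) \<in> K"
    then obtain w v where "w \<in> W" "(v, s) \<in> V" "g = w + v"
      by (auto simp: K_def)
    note g = this
    have "- (laurent_x (- s) *s w) \<in> W"
      using g by (intro laurent_vec.subspace_neg[OF W] laurent_vec.subspace_scale[OF W])
    moreover have "(- (laurent_x (- s) *s v), - s) \<in> V"
      using g by (intro subgroup_wreathD(3)[OF V])
    ultimately show "(- (laurent_x (- s) *s g), - s) \<in> K"
      by (rule KI) (simp add: g laurent_vec.scale_right_distrib)
  qed
  moreover have "V \<subseteq> K"
  proof
    fix g assume "g \<in> V"
    then show "g \<in> K"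
      by (cases g) (auto intro: KI[OF laurent_vec.subspace_0[OF W]])
  qed
  ultimately consider "K = V" | "K = UNIV"
    using max by blast
  then show "W = V\<^sub>0 \<or> W = UNIV"
  proof cases
    case 1
    have "w \<in> V\<^sub>0" if "w \<in> W" for w
    proof -
      have "(w, 0) \<in> K"
        by (rule KI[OF that subgroup_wreathD(1)[OF V]]) simp
      with 1 show ?thesis by (simp add: mem_V\<^sub>0)
    qed
    with \<open>V\<^sub>0 \<subseteq> W\<close> show ?thesis by blast
  next
    case 2
    have "a \<in> W" for a
    proof -
      have "(a, 0) \<in> K" using 2 by simp
      then obtain w v where "w \<in> W" "(v, 0) \<in> V" "a = w + v"
        by (auto simp: K_def)
      then show ?thesis
        using laurent_vec.subspace_add[OF W] \<open>V\<^sub>0 \<subseteq> W\<close> mem_V\<^sub>0 by blast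
    qed
    then show ?thesis by blast
  qed
qed

end

section \<open>Normality and the polynomial 1 - x\<close>

lemma laurent_of_poly_one_minus_x: "laurent_of_poly [:1, - 1:] = 1 - laurent_x 1"
  by (simp add: laurent_of_poly_pCons single_uminus)

text \<open>Consecutive powers of \<open>x\<close> differ by a multiple of \<open>1 - x\<close>, so
  the claim spreads from \<open>s = 0\<close> in both directions. It makes every shift trivial
  modulo \<open>(1 - x) R^n\<close>.\<close>

lemma one_minus_x_dvd: "laurent_of_poly [:1, - 1:] dvd (laurent_x s - 1 :: 'p::prime_card laurent)"
proof (induction s rule: int_induct[where k = 0])
  case (step1 s)
  have "laurent_x (s + 1) - 1 = (laurent_x s - 1 :: 'p laurent) - laurent_of_poly [:1, - 1:] * laurent_x s"
    by (simp add: laurent_of_poly_one_minus_x left_diff_distrib add.commute[of s] laurent_x_add)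
  then show ?case
    by (simp only: dvd_diff[OF step1(2) dvd_triv_left])
next
  case (step2 s)
  have "laurent_x s = (laurent_x 1 * laurent_x (s - 1) :: 'p laurent)"
    by (simp flip: laurent_x_add)
  then have "laurent_x (s - 1) - 1 = (laurent_x s - 1 :: 'p laurent) + laurent_of_poly [:1, - 1:] * laurent_x (s - 1)"
    by (simp add: laurent_of_poly_one_minus_x left_diff_distrib)
  then show ?case
    by (simp only: dvd_add[OF step2(2) dvd_triv_left])
qed simp

lemma normal_iff_det:
  fixes V :: "(('p::prime_card, 'n::finite) base \<times> int) set"
  assumes V: "subgroup V wreath" and surj: "snd ` V = UNIV"
    and "maximal_submodule {w. (w, 0) \<in> V} f"
  shows "V \<lhd> wreath \<longleftrightarrow> f = [:1, - 1:]"
proof -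
  interpret maximal_submodule "{w. (w, 0) \<in> V}" f by fact
  let ?V0 = "{w. (w, 0) \<in> V}"
  show ?thesis
  proof
    assume "V \<lhd> wreath"
    then have conj: "\<And>g h. h \<in> V \<Longrightarrow> g \<otimes>\<^bsub>wreath\<^esub> h \<otimes>\<^bsub>wreath\<^esub> inv\<^bsub>wreath\<^esub> g \<in> V"
      unfolding group.normal_inv_iff[OF group_wreath] carrier_wreath by blast
    obtain v where v: "(v, 1) \<in> V" by (rule lift[OF V surj])
    obtain e where e: "e \<notin> ?V0" using proper by blast
    have "(e + v - laurent_x 1 *s e, 1) \<in> V"
      using conj[OF v, of "(e, 0)"] by (simp add: mult_wreath inv_wreath)
    \<comment> \<open>Multiplying the conjugate by the inverse of \<open>(v, 1)\<close> leaves the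
      commutator \<open>((1 - x) e, 0)\<close>.\<close>
    from subgroup_wreathD(2)[OF V this subgroup_wreathD(3)[OF V v]]
    have "laurent_of_poly [:1, - 1:] *s e \<in> ?V0"
      by (simp add: laurent_of_poly_one_minus_x laurent_vec.scale_left_diff_distrib)
    then have "f dvd [:1, - 1:]"
      using ann_iff[OF e] laurent_of_poly_dvd_iff[of f "[:1, - 1:]"] f_0 by simp
    then obtain k where k: "[:1, - 1:] = f * k" ..
    have "k \<noteq> 0"
      using k by auto
    with f_nonzero have "degree [:1, - 1 :: 'p mod_ring:] = degree f + degree k"
      unfolding k by (rule degree_mult_eq)
    then have "degree f + degree k = 1"
      by simp
    \<comment> \<open>Being irreducible, \<open>f\<close> takes up the whole degree 1, so the
      cofactor \<open>k\<close> is constant, and constant terms show that it is 1.\<close>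
    moreover have "degree f \<noteq> 0"
      using irred f_nonzero by (auto simp: irreducible_def is_unit_iff_degree)
    ultimately have "degree k = 0" by simp
    then obtain c where c: "k = [:c:]" by (rule degree_eq_zeroE)
    moreover from arg_cong[OF k, of "\<lambda>u. poly u 0"] have "c = 1"
      by (simp add: f_0 c)
    ultimately show "f = [:1, - 1:]"
      using k by simp
  next
    assume f: "f = [:1, - 1:]"
    have x_diff: "laurent_x s *s w - w \<in> ?V0" for s w
      using ann[of "laurent_x s - 1" w] one_minus_x_dvd[of s]
      by (simp only: f laurent_vec.scale_left_diff_distrib laurent_vec.scale_one)
    have "g \<otimes>\<^bsub>wreath\<^esub> h \<otimes>\<^bsub>wreath\<^esub> inv\<^bsub>wreath\<^esub> g \<in> V" if h: "h \<in> V" for g h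
    proof -
      obtain a b where g_eq: "g = (a, b)" by (cases g)
      obtain w t where h_eq: "h = (w, t)" by (cases h)
      \<comment> \<open>\<open>(?u, 0)\<close> is the commutator of \<open>g\<close> and
        \<open>h\<close>; both of its brackets lie in \<open>?V0\<close> by
        \<open>x_diff\<close>.\<close>
      let ?u = "(laurent_x b *s w - w) - (laurent_x t *s a - a)"
      have "laurent_x (b + t) *s (laurent_x (- b) *s a) = laurent_x t *s a"
        by (simp only: vector_smult_assoc flip: laurent_x_add) simp
      then have "g \<otimes>\<^bsub>wreath\<^esub> h \<otimes>\<^bsub>wreath\<^esub> inv\<^bsub>wreath\<^esub> g = (?u + w, t)"
        by (simp add: g_eq h_eq mult_wreath inv_wreath)
      moreover have "(?u, 0) \<in> V"
        using laurent_vec.subspace_diff[OF subspace x_diff x_diff] by blast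
      ultimately show ?thesis
        using subgroup_wreathD(2)[OF V, of ?u 0 w t] h h_eq by simp
    qed
    with V show "V \<lhd> wreath"
      by (simp add: group.normal_inv_iff[OF group_wreath])
  qed
qed

theorem theorem3p11:
  fixes V :: "(('p::prime_card, 'n::finite) base \<times> int) set"
  assumes "maximal_subgroup V wreath"
  shows
    "finite (rcosets\<^bsub>wreath\<^esub> V) \<and>
     ((\<exists>q::nat. Factorial_Ring.prime q \<and> V = base_rtimes q) \<or>
      (\<exists>V0 v. has_triple V 1 V0 v \<and> Factorial_Ring.irreducible (det_star V0))) \<and>
     (\<forall>q::nat. Factorial_Ring.prime q \<and> V = base_rtimes q \<longrightarrow>
        card (rcosets\<^bsub>wreath\<^esub> V) = q \<and> V \<lhd> wreath) \<and>
     (\<forall>V0 v. has_triple V 1 V0 v \<longrightarrow>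
        card (rcosets\<^bsub>wreath\<^esub> V) = CARD('p) ^ degree (det_star V0) \<and>
        (V \<lhd> wreath \<longleftrightarrow> det_star V0 = [:1, - 1:]))"
proof -
  let ?V0 = "{w. (w, 0) \<in> V}"
  have V: "subgroup V wreath"
    using assms by (simp add: maximal_subgroup_def)
  have surj_case: "Factorial_Ring.irreducible (det_star ?V0)"
    "card (rcosets\<^bsub>wreath\<^esub> V) = CARD('p) ^ degree (det_star ?V0)"
    "V \<lhd> wreath \<longleftrightarrow> det_star ?V0 = [:1, - 1:]" if surj: "snd ` V = UNIV"
  proof -
    obtain f where f: "maximal_submodule ?V0 f"
      by (rule maximal_submodule_exists[OF maximal_subspace_V\<^sub>0[OF V surj assms]])
    note det = maximal_submodule.det_star_eq[OF f]
    show "Factorial_Ring.irreducible (det_star ?V0)"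
      unfolding det by (rule maximal_submodule.irred[OF f])
    show "card (rcosets\<^bsub>wreath\<^esub> V) = CARD('p) ^ degree (det_star ?V0)"
      unfolding det card_rcosets_eq_card_cosets[OF V surj] by (rule maximal_submodule.card_cosets[OF f])
    show "V \<lhd> wreath \<longleftrightarrow> det_star ?V0 = [:1, - 1:]"
      unfolding det by (rule normal_iff_det[OF V surj f])
  qed
  have base_case: "card (rcosets\<^bsub>wreath\<^esub> V) = q" "V \<lhd> wreath"
    if "Factorial_Ring.prime q" "V = base_rtimes q" for q
    unfolding that(2) using card_rcosets_base_rtimes[OF prime_gt_0_nat[OF that(1)]] normal_base_rtimes
    by this+
  have triple: "has_triple V 1 V0 v \<longleftrightarrow> snd ` V = UNIV \<and> V0 = ?V0 \<and> (v, 1) \<in> V" for V0 v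
    by (simp add: has_triple_def)
  have dichotomy: "(\<exists>q::nat. Factorial_Ring.prime q \<and> V = base_rtimes q) \<or> snd ` V = UNIV"
    using assms by (rule maximal_subgroup_wreath_cases) blast+
  \<comment> \<open>An infinite set has \<open>card\<close> equal to 0, so a positive index formula
    in each case also yields finiteness.\<close>
  have "0 < card (rcosets\<^bsub>wreath\<^esub> V)"
    using dichotomy
  proof (elim disjE exE conjE)
    fix q assume q: "Factorial_Ring.prime q" "V = base_rtimes q"
    show ?thesis
      unfolding base_case(1)[OF q] using q(1) by (rule prime_gt_0_nat)
  next
    assume "snd ` V = UNIV"
    then show ?thesis by (simp add: surj_case(2))
  qed
  moreover have "(\<exists>q::nat. Factorial_Ring.prime q \<and> V = base_rtimes q) \<or>
      (\<exists>V0 v. has_triple V 1 V0 v \<and> Factorial_Ring.irreducible (det_star V0))"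
    using dichotomy
  proof (rule disj_forward)
    assume surj: "snd ` V = UNIV"
    obtain v where "(v, 1) \<in> V" using lift[OF V surj] .
    then show "\<exists>V0 v. has_triple V 1 V0 v \<and> Factorial_Ring.irreducible (det_star V0)"
      unfolding triple using surj surj_case(1) by blast
  qed
  moreover have "finite (rcosets\<^bsub>wreath\<^esub> V)"
    using \<open>0 < card (rcosets\<^bsub>wreath\<^esub> V)\<close> by (rule card_ge_0_finite)
  ultimately show ?thesis
    unfolding triple using base_case surj_case(2,3) by (intro conjI allI impI) auto
qed

end
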